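(* Let $f:\mathbb{D}\to\mathbb{D}$ be an analytic function with $f(0)=0$. Suppose there exist real numbers $\{\alpha_1,\alpha_2,\ldots,\alpha_k\}\subset(0,1)$ (with $k\ge 1$) such that $f(\mathbb{D})\cap\{\alpha_1,\alpha_2,\ldots,\alpha_k\}=\emptyset$. Then $$|f'(0)|\le \frac{2\ln\left(\frac{1}{\alpha_1\alpha_2\cdots\alpha_k}\right)}{\frac{1-\alpha_1^2}{\alpha_1}+\frac{1-\alpha_2^2}{\alpha_2}+\cdots+\frac{1-\alpha_k^2}{\alpha_k}}.$$
   Context: $\mathbb{D}=\{z\in\mathbb{C}: |z|<1\}$ is the open unit disk in the complex plane, and $\ln$ is the real natural logarithm. *)

theory Defs
  imports "HOL-Complex_Analysis.Complex_Analysis"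
begin

end

(* Compose f with the Blaschke product B whose zeros are the omitted values. The composite
   maps the disc into the punctured disc, so it has a holomorphic logarithm with values in the
   left half-plane. The Schwarz lemma, transported to the half-plane by a Cayley transform,
   bounds the logarithmic derivative at 0 by 2 ln (1 / |B 0|); that derivative is
   f' 0 * B' 0 / B 0, and the logarithmic derivative of B at 0 is minus the sum of
   (1 - a^2) / a over the zeros a. *)

theory Submission imports Defs begin

text \<open>The Cayley transform w -> (w - \<open>h 0\<close>) / (w + \<open>cnj (h 0)\<close>)
  sends the left half-plane into the disc and \<open>h 0\<close> to 0. Its derivative at
  \<open>h 0\<close> is 1 / (2 \<open>Re (h 0)\<close>), so the Schwarz bound 1 on the composite
  becomes the stated one.\<close>

lemma norm_deriv_le_left_half_plane:
  assumes holh: "h holomorphic_on ball 0 1"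
    and neg: "\<And>z. norm z < 1 \<Longrightarrow> Re (h z) < 0"
  shows "norm (deriv h 0) \<le> - 2 * Re (h 0)"
proof -
  define \<phi> where "\<phi> z = (h z - h 0) / (h z + cnj (h 0))" for z
  have h0: "Re (h 0) < 0"
    using neg by simp
  have nz: "h z + cnj (h 0) \<noteq> 0" if "norm z < 1" for z
    using neg[OF that] h0 by (auto simp: complex_eq_iff)
  have hol: "\<phi> holomorphic_on ball 0 1"
    unfolding \<phi>_def using nz by (intro holomorphic_intros holh) auto
  have lt: "norm (\<phi> z) < 1" if "norm z < 1" for z
  proof -
    \<comment> \<open>\<open>h z\<close> lies closer to \<open>h 0\<close> than to the mirror image
      \<open>- cnj (h 0)\<close> in the imaginary axis; the gap of the squared distances is a
      product of two negative real parts.\<close>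
    have "(norm (h z + cnj (h 0)))\<^sup>2 - (norm (h z - h 0))\<^sup>2 = 4 * (Re (h z) * Re (h 0))"
      by (simp add: cmod_power2) (simp add: power2_eq_square algebra_simps)
    also have "\<dots> > 0"
      using neg[OF that] h0 by (simp add: mult_neg_neg)
    finally have "norm (h z - h 0) < norm (h z + cnj (h 0))"
      by (simp add: power2_less_imp_less)
    then show ?thesis
      unfolding \<phi>_def norm_divide using nz[OF that] by simp
  qed
  have le: "norm (deriv \<phi> 0) \<le> 1"
    by (rule Schwarz_Lemma(2)[OF hol _ lt, of 0]) (auto simp: \<phi>_def)
  have dh: "(h has_field_derivative deriv h 0) (at 0)"
    using holomorphic_derivI[OF holh] by simp
  have "(\<phi> has_field_derivative deriv h 0 / (h 0 + cnj (h 0))) (at 0)"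
    unfolding \<phi>_def using nz[of 0]
    by (auto intro!: derivative_eq_intros dh simp: divide_simps)
  then have "deriv \<phi> 0 = deriv h 0 / (h 0 + cnj (h 0))"
    by (rule DERIV_imp_deriv)
  moreover have "norm (h 0 + cnj (h 0)) = - 2 * Re (h 0)"
    using h0 by (simp only: complex_add_cnj norm_of_real)
  ultimately have "norm (deriv h 0) / (- 2 * Re (h 0)) \<le> 1"
    using le by (simp only: norm_divide)
  then show ?thesis
    using h0 by (subst (asm) pos_divide_le_eq) auto
qed

text \<open>The disc is contractible, so g = exp h with \<open>h\<close> holomorphic; norm (g z) < 1
  says exactly that \<open>Re (h z)\<close> is negative. The half-plane bound then applies to
  \<open>h\<close>, whose derivative is the logarithmic derivative of \<open>g\<close>.\<close>

lemma norm_deriv_le_punctured_disc: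
  assumes holg: "g holomorphic_on ball 0 1"
    and lt: "\<And>z. norm z < 1 \<Longrightarrow> norm (g z) < 1"
    and nz: "\<And>z. norm z < 1 \<Longrightarrow> g z \<noteq> 0"
  shows "norm (deriv g 0) \<le> 2 * norm (g 0) * ln (1 / norm (g 0))"
proof -
  obtain h where holh: "h holomorphic_on ball 0 1"
    and h: "\<And>z. z \<in> ball 0 1 \<Longrightarrow> g z = exp (h z)"
    using contractible_imp_holomorphic_log[OF holg] nz
    by (metis convex_ball convex_imp_contractible mem_ball_0)
  have "Re (h z) < 0" if "norm z < 1" for z
    using lt[OF that] h[of z] that by simp
  then have le: "norm (deriv h 0) \<le> - 2 * Re (h 0)"
    by (rule norm_deriv_le_left_half_plane[OF holh])
  have "((\<lambda>z. exp (h z)) has_field_derivative exp (h 0) * deriv h 0) (at 0)"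
    using holomorphic_derivI[OF holh] by (auto intro!: derivative_eq_intros)
  then have "(g has_field_derivative exp (h 0) * deriv h 0) (at 0)"
    by (rule has_field_derivative_transform_within_open[of _ _ _ "ball 0 1"]) (auto simp: h)
  then have "deriv g 0 = g 0 * deriv h 0"
    using DERIV_imp_deriv h by force
  moreover have "ln (1 / norm (g 0)) = - Re (h 0)"
    using h[of 0] by (simp add: ln_div)
  ultimately show ?thesis
    using mult_left_mono[OF le, of "norm (g 0)"] by (simp add: norm_mult algebra_simps)
qed

text \<open>The Blaschke factor (w - a) / (1 - a w) has derivative 1 - a^2 at w = 0, and the chain
  rule evaluates it there because f z = 0.\<close>

lemma has_field_derivative_Moebius_function_compose:
  fixes a :: real
  assumes "(f has_field_derivative f') (at z)" "f z = 0"
  shows "((\<lambda>w. Moebius_function 0 a (f w)) has_field_derivative f' * (1 - a\<^sup>2)) (at z)"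
  unfolding Moebius_function_simple
  using assms by (auto intro!: derivative_eq_intros simp: power2_eq_square algebra_simps)

theorem theorem1:
  fixes f :: "complex \<Rightarrow> complex" and \<alpha> :: "nat \<Rightarrow> real" and k :: nat
  assumes "f analytic_on ball 0 1"
    and "f ` ball 0 1 \<subseteq> ball 0 1"
    and "f 0 = 0"
    and "k \<ge> 1"
    and "\<alpha> ` {1..k} \<subseteq> {0<..<1}"
    and "f ` ball 0 1 \<inter> (\<lambda>i. complex_of_real (\<alpha> i)) ` {1..k} = {}"
  shows "norm (deriv f 0) \<le>
    2 * ln (1 / (\<Prod>i = 1..k. \<alpha> i)) / (\<Sum>i = 1..k. (1 - (\<alpha> i)\<^sup>2) / \<alpha> i)"
proof -
  \<comment> \<open>\<open>M i\<close> is the Blaschke factor with zero \<alpha> i composed with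
    \<open>f\<close>, so \<open>g\<close> is B composed with \<open>f\<close>.\<close>
  define M where "M i z = Moebius_function 0 (complex_of_real (\<alpha> i)) (f z)" for i z
  define g where "g z = (\<Prod>i = 1..k. M i z)" for z
  define P where "P = (\<Prod>i = 1..k. \<alpha> i)"
  define S where "S = (\<Sum>i = 1..k. (1 - (\<alpha> i)\<^sup>2) / \<alpha> i)"
  have \<alpha>: "0 < \<alpha> i" "\<alpha> i < 1" if "i \<in> {1..k}" for i
    using assms(5) that by (auto simp: image_subset_iff)
  have holf: "f holomorphic_on ball 0 1"
    using assms(1) by (rule analytic_imp_holomorphic)
  have f1: "norm (f z) < 1" if "norm z < 1" for z
    using assms(2) that by (auto simp: image_subset_iff)
  have omit: "f z \<noteq> of_real (\<alpha> i)" if "norm z < 1" "i \<in> {1..k}" for z i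
    using assms(6) that by (force simp: disjoint_iff)
  have Mlt: "norm (M i z) < 1" if "i \<in> {1..k}" "norm z < 1" for i z
    unfolding M_def using \<alpha>[OF that(1)] f1[OF that(2)] by (intro Moebius_function_norm_lt_1) auto
  have Mnz: "M i z \<noteq> 0" if "i \<in> {1..k}" "norm z < 1" for i z
  proof -
    \<comment> \<open>Since x / 0 = 0, a nonzero quotient requires a nonzero denominator as well as
      a nonzero numerator.\<close>
    have "norm (of_real (\<alpha> i) * f z) < 1"
      using \<alpha>[OF that(1)] f1[OF that(2)]
      by (metis abs_of_pos mult_strict_mono' mult_1 norm_ge_zero norm_mult norm_of_real)
    then have "1 - of_real (\<alpha> i) * f z \<noteq> 0"
      by auto
    then show ?thesis
      using omit[OF that(2,1)] by (simp add: M_def Moebius_function_simple)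
  qed
  have holM: "M i holomorphic_on ball 0 1" if "i \<in> {1..k}" for i
    using holomorphic_on_compose_gen[OF holf Moebius_function_holomorphic assms(2), of "of_real (\<alpha> i)" 0]
      \<alpha>[OF that] by (simp add: M_def[abs_def] o_def)
  have holg: "g holomorphic_on ball 0 1"
    unfolding g_def[abs_def] by (intro holomorphic_on_prod holM)
  have glt: "norm (g z) < 1" if "norm z < 1" for z
  proof -
    \<comment> \<open>An empty product would be 1; k \<ge> 1 supplies index 1 as a factor where the
      inequality is strict.\<close>
    have "(\<Prod>i = 1..k. norm (M i z)) < (\<Prod>i = 1..k. 1)"
      using assms(4) Mlt that Mnz
      by (intro prod_mono_strict[where i = 1]) (auto intro: less_imp_le)
    then show ?thesis
      by (simp add: g_def prod_norm)
  qed
  have gnz: "g z \<noteq> 0" if "norm z < 1" for z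
    using Mnz that by (auto simp: g_def)
  have Ppos: "P > 0"
    unfolding P_def using \<alpha> by (intro prod_pos) auto
  have Spos: "S > 0"
    unfolding S_def using \<alpha> assms(4)
    by (intro sum_pos divide_pos_pos) (auto simp: abs_square_less_1 abs_less_iff intro: less_trans[of _ 0])
  have M0: "M i 0 = - of_real (\<alpha> i)" for i
    by (simp add: M_def Moebius_function_of_zero assms(3))
  have g0: "norm (g 0) = P"
    using \<alpha> by (auto simp: g_def P_def M0 simp flip: prod_norm intro!: prod.cong abs_of_pos)
  have df: "(f has_field_derivative deriv f 0) (at 0)"
    using holomorphic_derivI[OF holf] by simp
  \<comment> \<open>The product rule in logarithmic form: \<open>g 0\<close> times the sum of the
    logarithmic derivatives of the factors, each divided by M i 0 = - \<alpha> i.\<close>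
  have "(g has_field_derivative g 0 * (\<Sum>i = 1..k. deriv f 0 * (1 - (of_real (\<alpha> i))\<^sup>2) / M i 0)) (at 0)"
    unfolding g_def[abs_def]
  proof (rule has_field_derivative_prod')
    fix i assume i: "i \<in> {1..k}"
    show "M i 0 \<noteq> 0"
      using Mnz[OF i] by simp
    show "(M i has_field_derivative deriv f 0 * (1 - (of_real (\<alpha> i))\<^sup>2)) (at 0)"
      using has_field_derivative_Moebius_function_compose[OF df assms(3), of "\<alpha> i"]
      by (simp add: M_def[abs_def])
  qed
  moreover have "(\<Sum>i = 1..k. deriv f 0 * (1 - (of_real (\<alpha> i))\<^sup>2) / M i 0) = - (deriv f 0 * of_real S)"
    by (simp add: M0 S_def sum_distrib_left sum_negf)
  ultimately have "deriv g 0 = - (g 0 * deriv f 0 * of_real S)"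
    using DERIV_imp_deriv by fastforce
  then have "norm (deriv g 0) = P * norm (deriv f 0) * S"
    using Spos by (simp add: norm_mult g0)
  \<comment> \<open>As norm (g 0) = P, the factor \<open>P\<close> stands on both sides and
    cancels.\<close>
  then have "P * norm (deriv f 0) * S \<le> 2 * P * ln (1 / P)"
    using norm_deriv_le_punctured_disc[OF holg glt gnz] g0 by simp
  then have "P * (norm (deriv f 0) * S) \<le> P * (2 * ln (1 / P))"
    by (simp only: mult.assoc mult.left_commute)
  then have "norm (deriv f 0) * S \<le> 2 * ln (1 / P)"
    using Ppos by (rule mult_left_le_imp_le)
  then have "norm (deriv f 0) \<le> 2 * ln (1 / P) / S"
    using Spos by (simp add: pos_le_divide_eq)
  then show ?thesis
    by (simp only: P_def S_def)
qed

end
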